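(* Let $k_n=k_n(x)$ be a (smooth) covariant vector field on $M$, let $$N^k_n=-l^k\,\frac{\partial F}{\partial x^n}-F\,m^k\left(\frac{\partial\theta}{\partial x^n}-k_n\right),\qquad N^k{}_{nm}=\frac{\partial N^k_n}{\partial y^m},\qquad D^k{}_{nm}=-N^k{}_{nm},$$ and let $\mathcal D_n$ be the covariant derivative defined by the pair $\{N^k_n,D^k{}_{nm}\}$. Then the following hold. 1. (Angle preservation.) For all $y_1,y_2\in T_xM$ in the region where $\theta$ is defined, with $\theta_a=\theta(x,y_a)$ and $d_n\theta_a=\frac{\partial\theta}{\partial x^n}(x,y_a)+N^k_n(x,y_a)\frac{\partial\theta}{\partial y^k}(x,y_a)$ for $a=1,2$, one has $d_n(\theta_2-\theta_1)=d_n\theta_2-d_n\theta_1=0$. 2. (Metricity.) $\mathcal D_iy_j=0$, that is, $d_iy_j-D^h{}_{ij}y_h=0$, and $$\mathcal D_ig_{jn}=d_ig_{jn}-D^h{}_{ij}g_{hn}-D^h{}_{in}g_{jh}=0 .$$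
   Context: $M$ is a 2-dimensional $C^\infty$ manifold; the consideration is local, in coordinates $x^1,x^2$ with induced fibre coordinates $y^1,y^2$ (no orientation-reversing changes). $F=F(x,y)$ is a Finsler metric function (positive, positively homogeneous of degree 1 in $y$, sufficiently smooth for $y\ne0$, with positive definite metric tensor), considered on an open conic region of nonzero tangent vectors. Notation: $l^k=y^k/F$, $y_k=F\,\partial F/\partial y^k$, $l_k=\partial F/\partial y^k=y_k/F$, $g_{ij}=\partial y_i/\partial y^j$, $g^{ij}$ its inverse. With $\gamma_{11}=\gamma_{22}=0$, $\gamma_{12}=-\gamma_{21}=1$, put $\epsilon_{ik}=\sqrt{\det(g_{mn})}\,\gamma_{ik}$, $m_i=-\epsilon_{ik}l^k$, $m^i=g^{ij}m_j$; then $g_{ij}=l_il_j+m_im_j$. The angle function $\theta=\theta(x,y)$ is a (smooth) function, positively homogeneous of degree zero in $y$, satisfying $F\,\partial\theta/\partial y^n=m_n$ on the region considered. Given coefficients $N^k_n(x,y)$ and $D^k{}_{nm}(x,y)$, put $d_n=\partial/\partial x^n+N^k_n\,\partial/\partial y^k$, and define the covariant derivative on tensors depending on $(x,y)$, e.g. of type $(1,1)$, by $\mathcal D_nw^k{}_m=d_nw^k{}_m+D^k{}_{nh}w^h{}_m-D^h{}_{nm}w^k{}_h$. Repeated indices (running over $1,2$) are summed. *)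

theory Defs
  imports "HOL-Analysis.Analysis"
begin

section \<open>Functions of class \<open>C\<^sup>k\<close>\<close>

definition dir_deriv :: "('a::real_normed_vector \<Rightarrow> real) \<Rightarrow> 'a \<Rightarrow> 'a \<Rightarrow> real" where
  "dir_deriv f v p = deriv (\<lambda>t. f (p + t *\<^sub>R v)) 0"

text \<open>To be used for open \<open>S\<close>, where this is the usual notion: all iterated partial
  derivatives up to order \<open>k\<close> exist and are continuous.\<close>

fun Ck_on :: "nat \<Rightarrow> ('a::euclidean_space \<Rightarrow> real) \<Rightarrow> 'a set \<Rightarrow> bool" where
  "Ck_on 0 f S \<longleftrightarrow> continuous_on S f"
| "Ck_on (Suc k) f S \<longleftrightarrow> f differentiable_on S \<and> (\<forall>b\<in>Basis. Ck_on k (dir_deriv f b) S)"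

definition smooth_on :: "('a::euclidean_space \<Rightarrow> real) \<Rightarrow> 'a set \<Rightarrow> bool" where
  "smooth_on f S \<longleftrightarrow> (\<forall>k. Ck_on k f S)"

section \<open>Functions of position and direction\<close>

text \<open>Everything is expressed in a chart, so points \<open>x\<close> and tangent vectors \<open>y\<close> both
  have type \<open>real^2\<close>.  A tensor component is a function of \<open>(x, y)\<close>; upper indices
  precede lower ones.\<close>

type_synonym fld = "real^2 \<Rightarrow> real^2 \<Rightarrow> real"

definition Dx :: "2 \<Rightarrow> fld \<Rightarrow> fld" where
  "Dx n f x y = dir_deriv (\<lambda>x'. f x' y) (axis n 1) x"

definition Dy :: "2 \<Rightarrow> fld \<Rightarrow> fld" where
  "Dy n f x y = dir_deriv (\<lambda>y'. f x y') (axis n 1) y"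

text \<open>An open conic region of nonzero tangent vectors over the coordinate domain \<open>U\<close>.\<close>

definition conic_region :: "(real^2) set \<Rightarrow> ((real^2) \<times> (real^2)) set \<Rightarrow> bool" where
  "conic_region U W \<longleftrightarrow> open U \<and> open W \<and> W \<subseteq> U \<times> (UNIV - {0}) \<and>
     (\<forall>x y. \<forall>t>0. (x, y) \<in> W \<longrightarrow> (x, t *\<^sub>R y) \<in> W)"

section \<open>Finsler objects\<close>

definition l_up :: "fld \<Rightarrow> 2 \<Rightarrow> fld" where
  "l_up F k x y = y $ k / F x y"

definition y_low :: "fld \<Rightarrow> 2 \<Rightarrow> fld" where
  "y_low F k x y = F x y * Dy k F x y"

definition g_low :: "fld \<Rightarrow> 2 \<Rightarrow> 2 \<Rightarrow> fld" where
  "g_low F i j = Dy j (y_low F i)"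

definition g_mat :: "fld \<Rightarrow> real^2 \<Rightarrow> real^2 \<Rightarrow> real^2^2" where
  "g_mat F x y = (\<chi> i j. g_low F i j x y)"

definition g_up :: "fld \<Rightarrow> 2 \<Rightarrow> 2 \<Rightarrow> fld" where
  "g_up F i j x y = matrix_inv (g_mat F x y) $ i $ j"

definition gam :: "2 \<Rightarrow> 2 \<Rightarrow> real" where
  "gam i k = (if i = 1 \<and> k = 2 then 1 else if i = 2 \<and> k = 1 then - 1 else 0)"

definition eps :: "fld \<Rightarrow> 2 \<Rightarrow> 2 \<Rightarrow> fld" where
  "eps F i k x y = sqrt (det (g_mat F x y)) * gam i k"

definition m_low :: "fld \<Rightarrow> 2 \<Rightarrow> fld" where
  "m_low F i x y = - (\<Sum>k\<in>UNIV. eps F i k x y * l_up F k x y)"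

definition m_up :: "fld \<Rightarrow> 2 \<Rightarrow> fld" where
  "m_up F i x y = (\<Sum>j\<in>UNIV. g_up F i j x y * m_low F j x y)"

text \<open>The regularity ``sufficiently smooth'' is read as \<open>C\<^sup>3\<close>, the order needed for
  the covariant derivative of the metric tensor to make sense.\<close>

definition finsler_on :: "((real^2) \<times> (real^2)) set \<Rightarrow> fld \<Rightarrow> bool" where
  "finsler_on W F \<longleftrightarrow>
     Ck_on 3 (\<lambda>(x, y). F x y) W \<and>
     (\<forall>(x, y)\<in>W. F x y > 0) \<and>
     (\<forall>(x, y)\<in>W. \<forall>t>0. F x (t *\<^sub>R y) = t * F x y) \<and>
     (\<forall>(x, y)\<in>W. \<forall>v. v \<noteq> 0 \<longrightarrow> v \<bullet> (g_mat F x y *v v) > 0)"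

text \<open>Since \<open>F \<partial>\<theta>/\<partial>y\<^sup>n = m\<^sub>n\<close> involves second derivatives of \<open>F\<close>, the angle function of
  a \<open>C\<^sup>3\<close> metric function is in general not of class \<open>C\<^sup>\<infinity>\<close>; the matching regularity
  is \<open>C\<^sup>2\<close>.\<close>

definition angle_function_on :: "((real^2) \<times> (real^2)) set \<Rightarrow> fld \<Rightarrow> fld \<Rightarrow> bool" where
  "angle_function_on W F \<theta> \<longleftrightarrow>
     Ck_on 2 (\<lambda>(x, y). \<theta> x y) W \<and>
     (\<forall>(x, y)\<in>W. \<forall>t>0. \<theta> x (t *\<^sub>R y) = \<theta> x y) \<and>
     (\<forall>(x, y)\<in>W. \<forall>n. F x y * Dy n \<theta> x y = m_low F n x y)"

section \<open>Connection coefficients and covariant derivatives\<close>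

definition N_coef :: "fld \<Rightarrow> fld \<Rightarrow> (2 \<Rightarrow> real^2 \<Rightarrow> real) \<Rightarrow> 2 \<Rightarrow> 2 \<Rightarrow> fld" where
  "N_coef F \<theta> kf k n x y =
     - l_up F k x y * Dx n F x y - F x y * m_up F k x y * (Dx n \<theta> x y - kf n x)"

definition D_coef :: "fld \<Rightarrow> fld \<Rightarrow> (2 \<Rightarrow> real^2 \<Rightarrow> real) \<Rightarrow> 2 \<Rightarrow> 2 \<Rightarrow> 2 \<Rightarrow> fld" where
  "D_coef F \<theta> kf k n m x y = - Dy m (N_coef F \<theta> kf k n) x y"

definition d_op :: "(2 \<Rightarrow> 2 \<Rightarrow> fld) \<Rightarrow> 2 \<Rightarrow> fld \<Rightarrow> fld" where
  "d_op N n f x y = Dx n f x y + (\<Sum>k\<in>UNIV. N k n x y * Dy k f x y)"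

text \<open>The operator \<open>d\<^sub>n\<close> on functions \<open>h(x, y\<^sub>1, y\<^sub>2)\<close> of two tangent vectors at the same
  point, which gives a meaning to \<open>d\<^sub>n(\<theta>\<^sub>2 - \<theta>\<^sub>1)\<close>:
  \<open>\<partial>/\<partial>x\<^sup>n + N\<^sup>k\<^sub>n(x,y\<^sub>1) \<partial>/\<partial>y\<^sub>1\<^sup>k + N\<^sup>k\<^sub>n(x,y\<^sub>2) \<partial>/\<partial>y\<^sub>2\<^sup>k\<close>.\<close>

definition d2_op :: "(2 \<Rightarrow> 2 \<Rightarrow> fld) \<Rightarrow> 2 \<Rightarrow> (real^2 \<Rightarrow> fld) \<Rightarrow> real^2 \<Rightarrow> fld" where
  "d2_op N n h x y\<^sub>1 y\<^sub>2 =
     dir_deriv (\<lambda>x'. h x' y\<^sub>1 y\<^sub>2) (axis n 1) x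
     + (\<Sum>k\<in>UNIV. N k n x y\<^sub>1 * dir_deriv (\<lambda>y. h x y y\<^sub>2) (axis k 1) y\<^sub>1)
     + (\<Sum>k\<in>UNIV. N k n x y\<^sub>2 * dir_deriv (\<lambda>y. h x y\<^sub>1 y) (axis k 1) y\<^sub>2)"

text \<open>Covariant derivatives of tensors of types \<open>(0,1)\<close> and \<open>(0,2)\<close>, as in
  \<open>\<D>\<^sub>n w\<^sup>k\<^sub>m = d\<^sub>n w\<^sup>k\<^sub>m + D\<^sup>k\<^sub>n\<^sub>h w\<^sup>h\<^sub>m - D\<^sup>h\<^sub>n\<^sub>m w\<^sup>k\<^sub>h\<close>.\<close>

definition cov_deriv1 ::
    "(2 \<Rightarrow> 2 \<Rightarrow> fld) \<Rightarrow> (2 \<Rightarrow> 2 \<Rightarrow> 2 \<Rightarrow> fld) \<Rightarrow> 2 \<Rightarrow> (2 \<Rightarrow> fld) \<Rightarrow> 2 \<Rightarrow> fld" where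
  "cov_deriv1 N D i w j x y =
     d_op N i (w j) x y - (\<Sum>h\<in>UNIV. D h i j x y * w h x y)"

definition cov_deriv2 ::
    "(2 \<Rightarrow> 2 \<Rightarrow> fld) \<Rightarrow> (2 \<Rightarrow> 2 \<Rightarrow> 2 \<Rightarrow> fld) \<Rightarrow> 2 \<Rightarrow> (2 \<Rightarrow> 2 \<Rightarrow> fld) \<Rightarrow> 2 \<Rightarrow> 2 \<Rightarrow> fld" where
  "cov_deriv2 N D i w j n x y =
     d_op N i (w j n) x y
     - (\<Sum>h\<in>UNIV. D h i j x y * w h n x y)
     - (\<Sum>h\<in>UNIV. D h i n x y * w j h x y)"

end

theory Submission
  imports Defs
begin

text \<open>
  The coefficients \<open>N\<^sup>k\<^sub>n\<close> are built so that the vector fields \<open>d\<^sub>n\<close> see \<open>F\<close> as a constant and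
  \<open>\<theta>\<close> as a function of position alone.  In the frame \<open>l\<^sup>k, m\<^sup>k\<close>, which is dual to
  \<open>l\<^sub>k = \<partial>F/\<partial>y\<^sup>k\<close> and \<open>m\<^sub>k = F \<partial>\<theta>/\<partial>y\<^sup>k\<close>, the \<open>l\<close>-part of \<open>N\<^sup>k\<^sub>n\<close> cancels \<open>\<partial>F/\<partial>x\<^sup>n\<close> and the
  \<open>m\<close>-part replaces \<open>\<partial>\<theta>/\<partial>x\<^sup>n\<close> by \<open>k\<^sub>n\<close>.  Hence \<open>d\<^sub>n F = 0\<close> (lemma \<open>d_op_F\<close>) and \<open>d\<^sub>n \<theta> = k\<^sub>n\<close>
  (lemma \<open>d_op_angle\<close>).  The value \<open>k\<^sub>n(x)\<close> is the same for all directions at \<open>x\<close>, which is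
  the preservation of angles.

  Metricity comes from differentiating these two identities in \<open>y\<close>.  If \<open>d\<^sub>i f\<close> depends on
  \<open>x\<close> only, then, second partial derivatives being symmetric,
  \<open>0 = \<partial>(d\<^sub>i f)/\<partial>y\<^sup>j = d\<^sub>i(\<partial>f/\<partial>y\<^sup>j) + (\<partial>N\<^sup>k\<^sub>i/\<partial>y\<^sup>j) \<partial>f/\<partial>y\<^sup>k\<close>,
  and the right-hand side is the covariant derivative of the covector \<open>\<partial>f/\<partial>y\<^sup>j\<close>, because
  \<open>D\<^sup>k\<^sub>i\<^sub>j = - \<partial>N\<^sup>k\<^sub>i/\<partial>y\<^sup>j\<close> (lemma \<open>cov_deriv1_vertical_gradient\<close>).  So \<open>l\<^sub>j\<close> and
  \<open>\<partial>\<theta>/\<partial>y\<^sup>j\<close> are parallel; as \<open>d\<^sub>i F = 0\<close>, so are their multiples \<open>y\<^sub>j\<close> and \<open>m\<^sub>j\<close> by the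
  factor \<open>F\<close>, and finally \<open>g\<^sub>j\<^sub>n = l\<^sub>j l\<^sub>n + m\<^sub>j m\<^sub>n\<close> (lemma \<open>g_decomposition\<close>).  This way only first
  derivatives of \<open>N\<^sup>k\<^sub>n\<close> enter, which is all that \<open>F\<close> of class \<open>C\<^sup>3\<close> and \<open>\<theta>\<close> of class
  \<open>C\<^sup>2\<close> provide; differentiating \<open>\<D>\<^sub>i y\<^sub>j = 0\<close> once more would need second ones.
\<close>

section \<open>Directional derivatives\<close>

lemma dir_deriv_eqI:
  assumes "((\<lambda>t. f (p + t *\<^sub>R v)) has_real_derivative d) (at 0)"
  shows "dir_deriv f v p = d"
  unfolding dir_deriv_def by (rule DERIV_imp_deriv[OF assms])

lemma dir_deriv_eq_frechet:
  fixes f :: "'a::real_normed_vector \<Rightarrow> real"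
  assumes "(f has_derivative f') (at p)"
  shows "dir_deriv f v p = f' v"
proof (rule dir_deriv_eqI)
  have g: "((\<lambda>t. p + t *\<^sub>R v) has_derivative (\<lambda>t. t *\<^sub>R v)) (at 0)"
    by (auto intro!: derivative_eq_intros)
  have "(f has_derivative f') (at (p + 0 *\<^sub>R v))" using assms by simp
  from has_derivative_compose[OF g this]
  show "((\<lambda>t. f (p + t *\<^sub>R v)) has_real_derivative f' v) (at 0)"
    using linear_cmul[OF has_derivative_linear[OF assms]]
    by (simp add: has_field_derivative_def mult.commute[of _ "f' v"])
qed

lemma dir_deriv_line:
  fixes f :: "'a::real_normed_vector \<Rightarrow> real"
  assumes "f differentiable at (p + s *\<^sub>R v)"
  shows "((\<lambda>t. f (p + t *\<^sub>R v)) has_real_derivative dir_deriv f v (p + s *\<^sub>R v)) (at s)"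
proof -
  obtain f' where f': "(f has_derivative f') (at (p + s *\<^sub>R v))"
    using assms by (auto simp: differentiable_def)
  have g: "((\<lambda>t. p + t *\<^sub>R v) has_derivative (\<lambda>t. t *\<^sub>R v)) (at s)"
    by (auto intro!: derivative_eq_intros)
  from has_derivative_compose[OF g f'] show ?thesis
    using linear_cmul[OF has_derivative_linear[OF f']]
    by (simp add: dir_deriv_eq_frechet[OF f'] has_field_derivative_def mult.commute[of _ "f' v"])
qed

lemma dir_deriv_cong_open:
  fixes f g :: "'a::real_normed_vector \<Rightarrow> real"
  assumes "open S" "p \<in> S" "\<And>q. q \<in> S \<Longrightarrow> f q = g q"
  shows "dir_deriv f v p = dir_deriv g v p"
proof -
  have "((\<lambda>t. p + t *\<^sub>R v) \<longlongrightarrow> p + 0 *\<^sub>R v) (nhds 0)"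
    by (intro tendsto_add tendsto_const tendsto_scaleR filterlim_ident)
  moreover have "\<forall>\<^sub>F q in nhds (p + 0 *\<^sub>R v). f q = g q"
    using assms by (auto simp: eventually_nhds)
  ultimately have "\<forall>\<^sub>F t in nhds 0. f (p + t *\<^sub>R v) = g (p + t *\<^sub>R v)"
    by (rule eventually_compose_filterlim[rotated])
  then show ?thesis unfolding dir_deriv_def by (rule deriv_cong_ev) simp
qed

lemma Ck_on_differentiable:
  assumes "Ck_on (Suc k) f S" "open S" "p \<in> S"
  shows "f differentiable at p"
  using assms by (auto simp: differentiable_on_eq_differentiable_at)

lemma Ck_on_Suc_imp:
  "Ck_on (Suc k) f S \<Longrightarrow> Ck_on k f S"
  by (induction k arbitrary: f) (auto simp: differentiable_imp_continuous_on)

text \<open>The mean value theorem applied in direction \<open>u\<close> and then in direction \<open>v\<close>.  The second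
  difference on the left is symmetric in \<open>u\<close> and \<open>v\<close>, the right-hand side is not: comparing
  both readings as \<open>h\<close> tends to zero yields the symmetry of second derivatives
  (Schwarz's theorem).\<close>

lemma second_difference_mean_value:
  fixes f :: "'a::euclidean_space \<Rightarrow> real"
  assumes f: "\<And>q. q \<in> ball p e \<Longrightarrow> f differentiable at q"
    and fu: "\<And>q. q \<in> ball p e \<Longrightarrow> dir_deriv f u differentiable at q"
    and h: "0 < h" "h * (norm u + norm v) < e"
  obtains q where "dist p q \<le> h * (norm u + norm v)"
    "f (p + h *\<^sub>R u + h *\<^sub>R v) - f (p + h *\<^sub>R u) - f (p + h *\<^sub>R v) + f p
       = h * h * dir_deriv (dir_deriv f u) v q"
proof -
  have near: "dist p (p + s *\<^sub>R u + t *\<^sub>R v) \<le> h * (norm u + norm v)"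
    if "0 \<le> s" "s \<le> h" "0 \<le> t" "t \<le> h" for s t
  proof -
    have "dist p (p + s *\<^sub>R u + t *\<^sub>R v) = norm (s *\<^sub>R u + t *\<^sub>R v)"
      using norm_minus_cancel[of "s *\<^sub>R u + t *\<^sub>R v"] by (simp add: dist_norm algebra_simps)
    also have "\<dots> \<le> s * norm u + t * norm v"
      using norm_triangle_ineq[of "s *\<^sub>R u" "t *\<^sub>R v"] that by simp
    also have "\<dots> \<le> h * norm u + h * norm v"
      using that by (intro add_mono mult_right_mono) auto
    finally show ?thesis by (simp add: algebra_simps)
  qed
  have inb: "p + s *\<^sub>R u + t *\<^sub>R v \<in> ball p e"
    if "0 \<le> s" "s \<le> h" "0 \<le> t" "t \<le> h" for s t
    using near[OF that] h by simp
  define phi where "phi = (\<lambda>s. f ((p + h *\<^sub>R v) + s *\<^sub>R u) - f (p + s *\<^sub>R u))"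
  have "(phi has_real_derivative
      dir_deriv f u ((p + h *\<^sub>R v) + s *\<^sub>R u) - dir_deriv f u (p + s *\<^sub>R u)) (at s)"
    if "0 \<le> s" "s \<le> h" for s
    unfolding phi_def using inb[of s h] inb[of s 0] that h
    by (intro DERIV_diff dir_deriv_line f) (simp_all add: ac_simps)
  from MVT2[OF h(1) this] obtain s where s: "0 < s" "s < h"
    "phi h - phi 0 = h * (dir_deriv f u ((p + h *\<^sub>R v) + s *\<^sub>R u) - dir_deriv f u (p + s *\<^sub>R u))"
    by auto
  have "((\<lambda>t. dir_deriv f u ((p + s *\<^sub>R u) + t *\<^sub>R v)) has_real_derivative
      dir_deriv (dir_deriv f u) v ((p + s *\<^sub>R u) + t *\<^sub>R v)) (at t)"
    if "0 \<le> t" "t \<le> h" for t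
    using inb[of s t] that s by (intro dir_deriv_line fu) simp
  from MVT2[OF h(1) this] obtain t where t: "0 < t" "t < h"
    "dir_deriv f u ((p + s *\<^sub>R u) + h *\<^sub>R v) - dir_deriv f u ((p + s *\<^sub>R u) + 0 *\<^sub>R v)
       = (h - 0) * dir_deriv (dir_deriv f u) v ((p + s *\<^sub>R u) + t *\<^sub>R v)"
    by auto
  show ?thesis
  proof (rule that)
    show "dist p (p + s *\<^sub>R u + t *\<^sub>R v) \<le> h * (norm u + norm v)"
      using near s t by simp
    have "f (p + h *\<^sub>R u + h *\<^sub>R v) - f (p + h *\<^sub>R u) - f (p + h *\<^sub>R v) + f p = phi h - phi 0"
      by (simp add: phi_def ac_simps)
    then show "f (p + h *\<^sub>R u + h *\<^sub>R v) - f (p + h *\<^sub>R u) - f (p + h *\<^sub>R v) + f p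
       = h * h * dir_deriv (dir_deriv f u) v (p + s *\<^sub>R u + t *\<^sub>R v)"
      using s(3) t(3) by (simp add: ac_simps)
  qed
qed

lemma dir_deriv_commute:
  fixes f :: "'a::euclidean_space \<Rightarrow> real"
  assumes C2: "Ck_on 2 f S" and S: "open S" "p \<in> S" and uv: "u \<in> Basis" "v \<in> Basis"
  shows "dir_deriv (dir_deriv f u) v p = dir_deriv (dir_deriv f v) u p"
proof -
  have C1: "Ck_on (Suc 0) (dir_deriv f b) S" and C0: "Ck_on (Suc 0) f S" if "b \<in> Basis" for b
    using C2 that by (auto simp: numeral_2_eq_2 differentiable_imp_continuous_on)
  have cont: "isCont (dir_deriv (dir_deriv f b) c) p" if "b \<in> Basis" "c \<in> Basis" for b c
    using C1[OF that(1)] that S by (simp add: continuous_on_eq_continuous_at)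
  have "\<bar>dir_deriv (dir_deriv f u) v p - dir_deriv (dir_deriv f v) u p\<bar> \<le> \<epsilon>" if "\<epsilon> > 0" for \<epsilon>
  proof -
    obtain e0 where e0: "e0 > 0" "ball p e0 \<subseteq> S" using S openE by blast
    have ev: "\<exists>d>0. \<forall>q. dist p q < d \<longrightarrow>
        \<bar>dir_deriv (dir_deriv f b) c q - dir_deriv (dir_deriv f b) c p\<bar> < \<epsilon> / 2"
      if "b \<in> Basis" "c \<in> Basis" for b c
      using cont[OF that, unfolded continuous_at_eps_delta, rule_format, of "\<epsilon> / 2"] \<open>\<epsilon> > 0\<close>
      by (simp add: dist_real_def dist_commute)
    from ev[OF uv] ev[OF uv(2,1)] obtain d1 d2 where d: "d1 > 0" "d2 > 0"
      "\<And>q. dist p q < d1 \<Longrightarrow>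
        \<bar>dir_deriv (dir_deriv f u) v q - dir_deriv (dir_deriv f u) v p\<bar> < \<epsilon> / 2"
      "\<And>q. dist p q < d2 \<Longrightarrow>
        \<bar>dir_deriv (dir_deriv f v) u q - dir_deriv (dir_deriv f v) u p\<bar> < \<epsilon> / 2" by blast
    define e where "e = min e0 (min d1 d2)"
    \<comment> \<open>Basis vectors have norm 1, so the parallelogram of side \<open>h\<close> stays in the ball of
      radius \<open>e\<close>.\<close>
    define h where "h = e / 4"
    have e: "e > 0" "e \<le> e0" "e \<le> d1" "e \<le> d2" using e0 d by (auto simp: e_def)
    have h: "0 < h" "h * (norm u + norm v) < e" "h * (norm v + norm u) < e"
      using e uv by (auto simp: h_def)
    have D: "f differentiable at q" "\<And>b. b \<in> Basis \<Longrightarrow> dir_deriv f b differentiable at q"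
      if "q \<in> ball p e" for q
      using Ck_on_differentiable[OF C0[OF uv(1)] S(1)] Ck_on_differentiable[OF C1 S(1)] that e(2) e0(2)
      by (auto simp: subset_iff)
    obtain q where q: "dist p q \<le> h * (norm u + norm v)"
      "f (p + h *\<^sub>R u + h *\<^sub>R v) - f (p + h *\<^sub>R u) - f (p + h *\<^sub>R v) + f p
       = h * h * dir_deriv (dir_deriv f u) v q"
      by (rule second_difference_mean_value[OF D(1) D(2)[OF _ uv(1)] h(1,2)])
    obtain r where r: "dist p r \<le> h * (norm v + norm u)"
      "f (p + h *\<^sub>R v + h *\<^sub>R u) - f (p + h *\<^sub>R v) - f (p + h *\<^sub>R u) + f p
       = h * h * dir_deriv (dir_deriv f v) u r"
      by (rule second_difference_mean_value[OF D(1) D(2)[OF _ uv(2)] h(1,3)])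
    have "h * h * dir_deriv (dir_deriv f u) v q = h * h * dir_deriv (dir_deriv f v) u r"
      using q(2) r(2) by (simp add: algebra_simps)
    then have "dir_deriv (dir_deriv f u) v q = dir_deriv (dir_deriv f v) u r"
      using h(1) by simp
    with d(3)[of q] d(4)[of r] q(1) r(1) e h show ?thesis by linarith
  qed
  then have "\<bar>dir_deriv (dir_deriv f u) v p - dir_deriv (dir_deriv f v) u p\<bar> \<le> 0"
    by (rule field_le_epsilon) simp
  then show ?thesis by simp
qed


lemma dir_deriv_add:
  assumes "f differentiable at p" "g differentiable at p"
  shows "dir_deriv (\<lambda>z. f z + g z) v p = dir_deriv f v p + dir_deriv g v p"
  using dir_deriv_line[of f p 0 v] dir_deriv_line[of g p 0 v] assms
  by (intro dir_deriv_eqI) (auto intro!: derivative_eq_intros)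

lemma dir_deriv_mult:
  assumes "f differentiable at p" "g differentiable at p"
  shows "dir_deriv (\<lambda>z. f z * g z) v p = dir_deriv f v p * g p + f p * dir_deriv g v p"
  using dir_deriv_line[of f p 0 v] dir_deriv_line[of g p 0 v] assms
  by (intro dir_deriv_eqI) (auto intro!: derivative_eq_intros)

section \<open>Calculus of functions of position and direction\<close>

abbreviation fdiff :: "fld \<Rightarrow> real^2 \<Rightarrow> real^2 \<Rightarrow> bool" where
  "fdiff f x y \<equiv> case_prod f differentiable at (x, y)"

text \<open>Both kinds of partial derivatives, and the operators \<open>d\<^sub>n\<close> as well, are derivatives in some
  direction of the product space, so that each rule of calculus is needed only once.\<close>

definition pd :: "(real^2) \<times> (real^2) \<Rightarrow> fld \<Rightarrow> fld" where
  "pd v f x y = dir_deriv (case_prod f) v (x, y)"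

lemma Dx_eq_pd: "Dx n f = pd (axis n 1, 0) f"
  by (simp add: fun_eq_iff Dx_def pd_def dir_deriv_def)

lemma Dy_eq_pd: "Dy n f = pd (0, axis n 1) f"
  by (simp add: fun_eq_iff Dy_def pd_def dir_deriv_def)

lemma case_prod_pd: "case_prod (pd v f) = dir_deriv (case_prod f) v"
  by (simp add: fun_eq_iff pd_def)

lemma horizontal_in_Basis: "(axis n (1::real), 0::real^2) \<in> Basis"
  and vertical_in_Basis: "(0::real^2, axis n (1::real)) \<in> Basis"
  by (simp_all add: Basis_prod_def image_iff axis_in_Basis_iff)

lemma pd_add:
  "fdiff f x y \<Longrightarrow> fdiff g x y \<Longrightarrow> pd v (\<lambda>x y. f x y + g x y) x y = pd v f x y + pd v g x y"
  using dir_deriv_add[of "case_prod f" "(x, y)" "case_prod g" v] by (simp add: pd_def case_prod_beta')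

lemma pd_mult:
  "fdiff f x y \<Longrightarrow> fdiff g x y \<Longrightarrow>
    pd v (\<lambda>x y. f x y * g x y) x y = pd v f x y * g x y + f x y * pd v g x y"
  using dir_deriv_mult[of "case_prod f" "(x, y)" "case_prod g" v] by (simp add: pd_def case_prod_beta')

lemma fdiff_add: "fdiff f x y \<Longrightarrow> fdiff g x y \<Longrightarrow> fdiff (\<lambda>x y. f x y + g x y) x y"
  and fdiff_diff: "fdiff f x y \<Longrightarrow> fdiff g x y \<Longrightarrow> fdiff (\<lambda>x y. f x y - g x y) x y"
  and fdiff_mult: "fdiff f x y \<Longrightarrow> fdiff g x y \<Longrightarrow> fdiff (\<lambda>x y. f x y * g x y) x y"
  and fdiff_minus: "fdiff f x y \<Longrightarrow> fdiff (\<lambda>x y. - f x y) x y"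
  by (simp_all add: case_prod_beta' differentiable_add differentiable_diff differentiable_mult)

lemma fdiff_divide:
  "fdiff f x y \<Longrightarrow> fdiff g x y \<Longrightarrow> g x y \<noteq> 0 \<Longrightarrow> fdiff (\<lambda>x y. f x y / g x y) x y"
  by (simp add: case_prod_beta' differentiable_divide)

lemma fdiff_sqrt:
  assumes "fdiff f x y" "f x y > 0"
  shows "fdiff (\<lambda>x y. sqrt (f x y)) x y"
proof -
  have "sqrt differentiable at (case_prod f (x, y))"
    using DERIV_real_sqrt[of "f x y"] assms(2) by (auto simp: real_differentiable_def)
  from differentiable_compose[OF this assms(1)] show ?thesis by (simp add: case_prod_beta')
qed

lemma fdiff_component: "fdiff (\<lambda>x y. y $ k) x y"
proof -
  have "bounded_linear (\<lambda>z::(real^2) \<times> (real^2). snd z $ k)"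
    by (intro bounded_linear_compose[OF bounded_linear_vec_nth] bounded_linear_snd)
  then show ?thesis
    by (simp add: case_prod_beta' bounded_linear_imp_differentiable)
qed

lemma Dy_component: "Dy j (\<lambda>x y. y $ k) x y = (if j = k then 1 else 0)"
  unfolding Dy_def
  by (rule dir_deriv_eqI) (auto simp: axis_def intro!: derivative_eq_intros)

lemma pd_cong_open:
  assumes "open W" "(x, y) \<in> W" "\<And>x y. (x, y) \<in> W \<Longrightarrow> f x y = g x y"
  shows "pd v f x y = pd v g x y"
  unfolding pd_def using assms by (intro dir_deriv_cong_open[of W]) auto

lemma fdiff_cong_open:
  assumes "open W" "(x, y) \<in> W" "\<And>x y. (x, y) \<in> W \<Longrightarrow> f x y = g x y" "fdiff g x y"
  shows "fdiff f x y"
proof -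
  obtain D where "(case_prod g has_derivative D) (at (x, y))"
    using assms(4) by (auto simp: differentiable_def)
  then have "(case_prod f has_derivative D) (at (x, y))"
    using assms has_derivative_transform_within_open[of "case_prod g" D "(x, y)" UNIV W "case_prod f"] by auto
  then show ?thesis by (auto simp: differentiable_def)
qed

lemma vertical_derivative_sum:
  assumes "fdiff f x y"
  shows "pd (w, v) f x y = pd (w, 0) f x y + (\<Sum>k\<in>UNIV. v $ k * Dy k f x y)"
proof -
  obtain f' where f': "(case_prod f has_derivative f') (at (x, y))"
    using assms by (auto simp: differentiable_def)
  then have lin: "linear f'" by (rule has_derivative_linear)
  have "(w, v) = (w, 0) + (v $ 1 *\<^sub>R (0, axis 1 1) + v $ 2 *\<^sub>R (0, axis 2 1))"
    by (auto simp: vec_eq_iff forall_2 axis_def)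
  then have "f' (w, v) = f' (w, 0) + (v $ 1 * f' (0, axis 1 1) + v $ 2 * f' (0, axis 2 1))"
    by (simp only: linear_add[OF lin] linear_cmul[OF lin] real_scaleR_def)
  then show ?thesis
    by (simp add: Dy_eq_pd pd_def dir_deriv_eq_frechet[OF f'] sum_2)
qed

text \<open>At each point \<open>d\<^sub>n\<close> is the derivative along the tangent vector with base component
  \<open>\<partial>/\<partial>x\<^sup>n\<close> and fibre component \<open>N\<^sub>n\<close>; the product rule for \<open>d\<^sub>n\<close> follows from this.\<close>

lemma d_op_eq_pd:
  assumes "fdiff f x y"
  shows "d_op N n f x y = pd (axis n 1, \<chi> k. N k n x y) f x y"
  using vertical_derivative_sum[OF assms, of "axis n 1" "\<chi> k. N k n x y"] by (simp add: d_op_def Dx_eq_pd)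

lemma d_op_add:
  "fdiff f x y \<Longrightarrow> fdiff g x y \<Longrightarrow>
    d_op N n (\<lambda>x y. f x y + g x y) x y = d_op N n f x y + d_op N n g x y"
  by (simp add: d_op_eq_pd fdiff_add pd_add)

lemma d_op_mult:
  "fdiff f x y \<Longrightarrow> fdiff g x y \<Longrightarrow>
    d_op N n (\<lambda>x y. f x y * g x y) x y = d_op N n f x y * g x y + f x y * d_op N n g x y"
  by (simp add: d_op_eq_pd fdiff_mult pd_mult)

lemma d_op_cong_open:
  assumes "open W" "(x, y) \<in> W" "\<And>x y. (x, y) \<in> W \<Longrightarrow> f x y = g x y"
  shows "d_op N n f x y = d_op N n g x y"
  unfolding d_op_def Dx_eq_pd Dy_eq_pd using pd_cong_open[OF assms] by simp

lemma Ck_on_Dx: "Ck_on (Suc k) (case_prod f) W \<Longrightarrow> Ck_on k (case_prod (Dx n f)) W"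
  and Ck_on_Dy: "Ck_on (Suc k) (case_prod f) W \<Longrightarrow> Ck_on k (case_prod (Dy n f)) W"
  using horizontal_in_Basis vertical_in_Basis
  by (auto simp: Dx_eq_pd Dy_eq_pd case_prod_pd)

lemma Dy_Dx_commute:
  assumes "Ck_on 2 (case_prod f) W" "open W" "(x, y) \<in> W"
  shows "Dy j (Dx i f) x y = Dx i (Dy j f) x y"
  using dir_deriv_commute[OF assms horizontal_in_Basis vertical_in_Basis]
  by (simp add: Dx_eq_pd Dy_eq_pd pd_def[of _ "pd _ f"] case_prod_pd)

lemma Dy_Dy_commute:
  assumes "Ck_on 2 (case_prod f) W" "open W" "(x, y) \<in> W"
  shows "Dy j (Dy i f) x y = Dy i (Dy j f) x y"
  using dir_deriv_commute[OF assms vertical_in_Basis vertical_in_Basis]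
  by (simp add: Dy_eq_pd pd_def[of _ "pd _ f"] case_prod_pd)

section \<open>Parallel covector fields\<close>

text \<open>Differentiating \<open>d\<^sub>i f = c(x)\<close> in \<open>y\<^sup>j\<close> kills the right-hand side and, by the symmetry of
  second derivatives, turns the left-hand side into the covariant derivative of
  \<open>\<partial>f/\<partial>y\<^sup>j\<close>.\<close>

lemma cov_deriv1_vertical_gradient:
  assumes W: "open W" "(x, y) \<in> W"
    and f: "Ck_on 2 (case_prod f) W"
    and N: "\<And>k. fdiff (N k i) x y"
    and c: "\<And>x y. (x, y) \<in> W \<Longrightarrow> d_op N i f x y = c x"
  shows "cov_deriv1 N (\<lambda>k n m x y. - Dy m (N k n) x y) i (\<lambda>j. Dy j f) j x y = 0"
proof -
  have f2: "Ck_on (Suc (Suc 0)) (case_prod f) W" using f by (simp only: numeral_2_eq_2)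
  have dx: "fdiff (Dx n f) x y" and dy: "fdiff (Dy n f) x y" for n
    using Ck_on_differentiable[OF Ck_on_Dx[OF f2] W] Ck_on_differentiable[OF Ck_on_Dy[OF f2] W] by auto
  have "0 = Dy j (\<lambda>x y. c x) x y"
    by (simp add: Dy_def dir_deriv_def)
  also have "\<dots> = Dy j (\<lambda>x y. Dx i f x y + (N 1 i x y * Dy 1 f x y + N 2 i x y * Dy 2 f x y)) x y"
    using c by (auto simp: Dy_eq_pd[of j] d_op_def sum_2 intro!: pd_cong_open[OF W])
  also have "\<dots> = Dy j (Dx i f) x y + (Dy j (N 1 i) x y * Dy 1 f x y + N 1 i x y * Dy j (Dy 1 f) x y
      + (Dy j (N 2 i) x y * Dy 2 f x y + N 2 i x y * Dy j (Dy 2 f) x y))"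
    by (simp add: Dy_eq_pd[of j] pd_add pd_mult fdiff_add fdiff_mult dx dy N)
  also have "\<dots> = d_op N i (Dy j f) x y + (\<Sum>k\<in>UNIV. Dy j (N k i) x y * Dy k f x y)"
    by (simp add: d_op_def sum_2 Dy_Dx_commute[OF f W] Dy_Dy_commute[OF f W, of j])
  finally show ?thesis by (simp add: cov_deriv1_def sum_negf)
qed

lemma cov_deriv1_scale:
  assumes "fdiff f x y" "fdiff (w j) x y" "d_op N i f x y = 0" "cov_deriv1 N D i w j x y = 0"
  shows "cov_deriv1 N D i (\<lambda>j x y. f x y * w j x y) j x y = 0"
proof -
  have "cov_deriv1 N D i (\<lambda>j x y. f x y * w j x y) j x y = f x y * cov_deriv1 N D i w j x y"
    using assms(3) by (simp add: cov_deriv1_def d_op_mult[OF assms(1,2)] sum_2 algebra_simps)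
  then show ?thesis using assms(4) by simp
qed

lemma cov_deriv2_sum_of_squares:
  assumes W: "open W" "(x, y) \<in> W"
    and t: "\<And>j n x y. (x, y) \<in> W \<Longrightarrow> t j n x y = v j x y * v n x y + w j x y * w n x y"
    and diff: "\<And>j. fdiff (v j) x y" "\<And>j. fdiff (w j) x y"
    and par: "\<And>j. cov_deriv1 N D i v j x y = 0" "\<And>j. cov_deriv1 N D i w j x y = 0"
  shows "cov_deriv2 N D i t j n x y = 0"
proof -
  have v: "d_op N i (v j) x y = (\<Sum>h\<in>UNIV. D h i j x y * v h x y)"
   and w: "d_op N i (w j) x y = (\<Sum>h\<in>UNIV. D h i j x y * w h x y)" for j
    using par[of j] by (simp_all add: cov_deriv1_def)
  have "d_op N i (t j n) x y = d_op N i (\<lambda>x y. v j x y * v n x y + w j x y * w n x y) x y"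
    using t by (intro d_op_cong_open[OF W])
  also have "\<dots> = d_op N i (v j) x y * v n x y + v j x y * d_op N i (v n) x y
      + (d_op N i (w j) x y * w n x y + w j x y * d_op N i (w n) x y)"
    by (simp add: d_op_add d_op_mult fdiff_mult diff)
  finally show ?thesis
    by (simp add: cov_deriv2_def t[OF W(2)] v w sum_2 algebra_simps)
qed

section \<open>Two-dimensional Finsler metrics with an angle function\<close>

locale finsler_angle =
  fixes W :: "((real^2) \<times> (real^2)) set" and F \<theta> :: fld
  assumes open_W: "open W"
    and finsler: "finsler_on W F"
    and angle: "angle_function_on W F \<theta>"
begin

lemma F_pos: "(x, y) \<in> W \<Longrightarrow> F x y > 0"
  and F_homogeneous: "(x, y) \<in> W \<Longrightarrow> t > 0 \<Longrightarrow> F x (t *\<^sub>R y) = t * F x y"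
  and g_pos: "(x, y) \<in> W \<Longrightarrow> v \<noteq> 0 \<Longrightarrow> v \<bullet> (g_mat F x y *v v) > 0"
  using finsler by (auto simp: finsler_on_def)

lemma F_Dy_angle: "(x, y) \<in> W \<Longrightarrow> F x y * Dy n \<theta> x y = m_low F n x y"
  using angle by (auto simp: angle_function_on_def)

lemma F_C3: "Ck_on (Suc (Suc (Suc 0))) (case_prod F) W"
  using finsler by (simp only: finsler_on_def numeral_3_eq_3)

lemma F_C2: "Ck_on 2 (case_prod F) W"
  using Ck_on_Suc_imp[OF F_C3] by (simp only: numeral_2_eq_2)

lemma angle_C2: "Ck_on 2 (case_prod \<theta>) W"
  using angle by (simp only: angle_function_on_def)

lemma angle_C2': "Ck_on (Suc (Suc 0)) (case_prod \<theta>) W"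
  using angle_C2 by (simp only: numeral_2_eq_2)

context
  fixes x y assumes W: "(x, y) \<in> W"
begin

lemma fdiff_F: "fdiff F x y"
  by (rule Ck_on_differentiable[OF F_C3 open_W W])

lemma fdiff_Dx_F: "fdiff (Dx n F) x y"
  by (rule Ck_on_differentiable[OF Ck_on_Dx[OF F_C3] open_W W])

lemma fdiff_Dy_F: "fdiff (Dy n F) x y"
  by (rule Ck_on_differentiable[OF Ck_on_Dy[OF F_C3] open_W W])

lemma fdiff_Dy_Dy_F: "fdiff (Dy m (Dy n F)) x y"
  by (rule Ck_on_differentiable[OF Ck_on_Dy[OF Ck_on_Dy[OF F_C3]] open_W W])

lemma fdiff_angle: "fdiff \<theta> x y"
  by (rule Ck_on_differentiable[OF angle_C2' open_W W])

lemma fdiff_Dx_angle: "fdiff (Dx n \<theta>) x y"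
  by (rule Ck_on_differentiable[OF Ck_on_Dx[OF angle_C2'] open_W W])

lemma fdiff_Dy_angle: "fdiff (Dy n \<theta>) x y"
  by (rule Ck_on_differentiable[OF Ck_on_Dy[OF angle_C2'] open_W W])

text \<open>Euler's identity \<open>y\<^sup>k \<partial>F/\<partial>y\<^sup>k = F\<close>: differentiate \<open>F(x, (1 + t) y) = (1 + t) F(x, y)\<close> at
  \<open>t = 0\<close>.\<close>

lemma euler_F: "y $ 1 * Dy 1 F x y + y $ 2 * Dy 2 F x y = F x y"
proof -
  have "pd (0, y) F x y = F x y"
    unfolding pd_def
  proof (rule dir_deriv_eqI)
    have "((\<lambda>t. (1 + t) * F x y) has_real_derivative F x y) (at 0)"
      by (auto intro!: derivative_eq_intros)
    then show "((\<lambda>t. (\<lambda>(x, y). F x y) ((x, y) + t *\<^sub>R (0, y))) has_real_derivative F x y) (at 0)"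
    proof (rule DERIV_cong_ev[THEN iffD1, OF refl _ refl, rotated])
      have "\<forall>\<^sub>F t in nhds 0. t > (- 1 :: real)"
        using eventually_nhds_in_open[of "{- 1<..}" "0 :: real"] by simp
      then show "\<forall>\<^sub>F t in nhds 0. (1 + t) * F x y = (\<lambda>(x, y). F x y) ((x, y) + t *\<^sub>R (0, y))"
      proof eventually_elim
        case (elim t)
        then show ?case
          using F_homogeneous[OF W, of "1 + t"] by (simp add: scaleR_left_distrib)
      qed
    qed
  qed
  moreover have "pd (0, 0) F x y = 0" by (simp add: pd_def dir_deriv_def)
  ultimately show ?thesis
    using vertical_derivative_sum[OF fdiff_F, of 0 y] by (simp add: sum_2)
qed

end

context
  fixes x y assumes W: "(x, y) \<in> W"
begin

text \<open>Differentiating Euler's identity in \<open>y\<^sup>j\<close>; the term \<open>\<partial>F/\<partial>y\<^sup>j\<close> cancels.\<close>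

lemma euler_Dy_F: "y $ 1 * Dy 1 (Dy j F) x y + y $ 2 * Dy 2 (Dy j F) x y = 0"
proof -
  have "Dy j F x y = Dy j (\<lambda>x y. y $ 1 * Dy 1 F x y + y $ 2 * Dy 2 F x y) x y"
    unfolding Dy_eq_pd[of j] by (rule pd_cong_open[OF open_W W]) (simp add: euler_F)
  also have "\<dots> = (Dy j (\<lambda>x y. y $ 1) x y * Dy 1 F x y + y $ 1 * Dy j (Dy 1 F) x y)
      + (Dy j (\<lambda>x y. y $ 2) x y * Dy 2 F x y + y $ 2 * Dy j (Dy 2 F) x y)"
    unfolding Dy_eq_pd[of j]
    by (simp add: pd_add pd_mult fdiff_mult fdiff_component fdiff_Dy_F W)
  finally show ?thesis
    using exhaust_2[of j]
    by (auto simp: Dy_component Dy_Dy_commute[OF F_C2 open_W W, of 1 2])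
qed

lemma g_low_eq: "g_low F i j x y = Dy i F x y * Dy j F x y + F x y * Dy j (Dy i F) x y"
proof -
  have "g_low F i j x y = pd (0, axis j 1) (\<lambda>x y. F x y * Dy i F x y) x y"
    by (simp add: g_low_def Dy_eq_pd[of j] y_low_def[abs_def])
  then show ?thesis by (simp add: pd_mult fdiff_F fdiff_Dy_F W Dy_eq_pd[of j])
qed

lemma g_sym: "g_low F i j x y = g_low F j i x y"
  using Dy_Dy_commute[OF F_C2 open_W W, of i j] by (simp add: g_low_eq)

text \<open>Here \<open>g\<^sub>j\<^sub>k = l\<^sub>j l\<^sub>k + F \<partial>\<^sup>2F/\<partial>y\<^sup>j\<partial>y\<^sup>k\<close>, and the Hessian of \<open>F\<close> annihilates \<open>l\<^sup>k\<close>, a multiple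
  of \<open>y\<^sup>k\<close>.\<close>

lemma euler_g: "g_low F j 1 x y * l_up F 1 x y + g_low F j 2 x y * l_up F 2 x y = Dy j F x y"
proof -
  have F: "F x y > 0" by (rule F_pos[OF W])
  have "F x y * (g_low F j 1 x y * l_up F 1 x y + g_low F j 2 x y * l_up F 2 x y)
      = Dy j F x y * (y $ 1 * Dy 1 F x y + y $ 2 * Dy 2 F x y)
        + F x y * (y $ 1 * Dy 1 (Dy j F) x y + y $ 2 * Dy 2 (Dy j F) x y)"
    using F by (simp add: g_low_eq l_up_def field_simps)
  then show ?thesis using F by (simp add: euler_F[OF W] euler_Dy_F)
qed

lemma euler_l: "Dy 1 F x y * l_up F 1 x y + Dy 2 F x y * l_up F 2 x y = 1"
  using euler_F[OF W] F_pos[OF W] by (simp add: l_up_def field_simps)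

lemma det_g: "det (g_mat F x y) = g_low F 1 1 x y * g_low F 2 2 x y - (g_low F 1 2 x y)\<^sup>2"
  by (simp add: det_2 g_mat_def g_sym[of 2 1] power2_eq_square)

lemma det_g_pos: "det (g_mat F x y) > 0"
proof -
  have quad: "v \<bullet> (g_mat F x y *v v) = g_low F 1 1 x y * (v $ 1)\<^sup>2
      + 2 * g_low F 1 2 x y * v $ 1 * v $ 2 + g_low F 2 2 x y * (v $ 2)\<^sup>2" for v
    by (simp add: inner_vec_def matrix_vector_mult_def g_mat_def sum_2 g_sym[of 2 1]
        power2_eq_square algebra_simps)
  have pos: "g_low F 1 1 x y > 0"
    using g_pos[OF W, of "axis 1 1"] unfolding quad by (simp add: axis_eq_0_iff) (simp add: axis_def)
  \<comment> \<open>The vector on which the quadratic form takes the value \<open>g\<^sub>1\<^sub>1 det g\<close>.\<close>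
  define v :: "real^2" where "v = vector [- g_low F 1 2 x y, g_low F 1 1 x y]"
  have "v \<noteq> 0" using pos by (auto simp: v_def vec_eq_iff forall_2)
  with g_pos[OF W, of v] have "0 < g_low F 1 1 x y * det (g_mat F x y)"
    by (simp add: quad det_g v_def power2_eq_square algebra_simps)
  with pos show ?thesis by (simp add: zero_less_mult_iff)
qed

lemma m_low_eq:
  "m_low F 1 x y = - sqrt (det (g_mat F x y)) * l_up F 2 x y"
  "m_low F 2 x y = sqrt (det (g_mat F x y)) * l_up F 1 x y"
  by (simp_all add: m_low_def eps_def gam_def sum_2)

text \<open>The identity \<open>g\<^sub>i\<^sub>j = l\<^sub>i l\<^sub>j + m\<^sub>i m\<^sub>j\<close> becomes polynomial in the three components of \<open>g\<close>
  and the two of \<open>l\<^sup>k\<close> once \<open>l\<^sub>j = g\<^sub>j\<^sub>k l\<^sup>k\<close> is inserted, modulo the relations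
  \<open>l\<^sub>k l\<^sup>k = 1\<close> and \<open>s\<^sup>2 = det g\<close>.\<close>

lemma g_decomposition:
  "g_low F i j x y = Dy i F x y * Dy j F x y + m_low F i x y * m_low F j x y"
proof -
  define a b where "a = l_up F 1 x y" and "b = l_up F 2 x y"
  define p q r where "p = g_low F 1 1 x y" and "q = g_low F 1 2 x y" and "r = g_low F 2 2 x y"
  define s where "s = sqrt (det (g_mat F x y))"
  have s: "s * s = p * r - q * q"
    using det_g_pos det_g by (simp add: s_def p_def q_def r_def power2_eq_square)
  have l: "Dy 1 F x y = p * a + q * b" "Dy 2 F x y = q * a + r * b"
    using euler_g[of 1] euler_g[of 2] by (simp_all add: a_def b_def p_def q_def r_def g_sym[of 2 1])
  have "Dy 1 F x y * a + Dy 2 F x y * b = 1"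
    by (simp only: a_def b_def euler_l)
  then have one: "(p * a + q * b) * a + (q * a + r * b) * b = 1"
    by (simp only: l)
  have m: "m_low F 1 x y = - s * b" "m_low F 2 x y = s * a"
    by (simp_all add: m_low_eq s_def a_def b_def)
  have "p = (p * a + q * b) * (p * a + q * b) + (- s * b) * (- s * b)"
    "q = (p * a + q * b) * (q * a + r * b) + (- s * b) * (s * a)"
    "r = (q * a + r * b) * (q * a + r * b) + (s * a) * (s * a)"
    using s one by algebra+
  then show ?thesis
    using exhaust_2[of i] exhaust_2[of j] g_sym[of 2 1]
    by (auto simp: l m p_def[symmetric] q_def[symmetric] r_def[symmetric] mult.commute)
qed

text \<open>Raising the index by solving \<open>g\<^sub>i\<^sub>j c\<^sup>j = m\<^sub>i\<close> avoids the inverse matrix: \<open>m\<^sup>k\<close> is \<open>l\<^sub>k\<close>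
  turned by a right angle and divided by \<open>sqrt (det g)\<close>.  This gives the duality of the frames
  \<open>l\<^sup>k, m\<^sup>k\<close> and \<open>l\<^sub>k, m\<^sub>k\<close>, and also the differentiability of \<open>m\<^sup>k\<close>.\<close>

lemma m_up_eq:
  "m_up F 1 x y = - Dy 2 F x y / sqrt (det (g_mat F x y))"
  "m_up F 2 x y = Dy 1 F x y / sqrt (det (g_mat F x y))"
proof -
  define G where "G = g_mat F x y"
  define s where "s = sqrt (det G)"
  define m where "m = (\<chi> i. m_low F i x y)"
  define c :: "real^2" where "c = vector [- Dy 2 F x y / s, Dy 1 F x y / s]"
  have s: "s > 0" "s * s = det G" using det_g_pos by (simp_all add: s_def G_def)
  have "g_low F 1 2 x y * Dy 1 F x y - g_low F 1 1 x y * Dy 2 F x y = - (s * s) * l_up F 2 x y"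
    "g_low F 2 2 x y * Dy 1 F x y - g_low F 1 2 x y * Dy 2 F x y = s * s * l_up F 1 x y"
    unfolding s(2) G_def
    by (simp_all add: det_g euler_g[symmetric] g_sym[of 2 1] power2_eq_square algebra_simps)
  then have "G *v c = m"
    using s(1)
    by (simp add: vec_eq_iff forall_2 matrix_vector_mult_def sum_2 c_def m_def G_def[symmetric] m_low_eq
        s_def[symmetric])
      (simp add: G_def g_mat_def g_sym[of 2 1] field_simps)
  moreover have "matrix_inv G ** G = mat 1"
  proof -
    have "invertible G" using det_g_pos by (simp add: invertible_det_nz G_def)
    then show ?thesis unfolding invertible_def matrix_inv_def by (rule someI2_ex) simp
  qed
  ultimately have "matrix_inv G *v m = c"
    by (metis matrix_vector_mul_assoc matrix_vector_mul_lid)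
  moreover have "m_up F i x y = (matrix_inv G *v m) $ i" for i
    by (simp add: m_up_def g_up_def G_def m_def matrix_vector_mult_def)
  ultimately show "m_up F 1 x y = - Dy 2 F x y / sqrt (det (g_mat F x y))"
    "m_up F 2 x y = Dy 1 F x y / sqrt (det (g_mat F x y))"
    by (simp_all add: c_def s_def G_def)
qed

lemma d_op_F: "d_op (N_coef F \<theta> kf) n F x y = 0"
proof -
  have "d_op (N_coef F \<theta> kf) n F x y
      = Dx n F x y * (1 - (Dy 1 F x y * l_up F 1 x y + Dy 2 F x y * l_up F 2 x y))
        - F x y * (Dx n \<theta> x y - kf n x)
          * (m_up F 1 x y * Dy 1 F x y + m_up F 2 x y * Dy 2 F x y)"
    by (simp add: d_op_def N_coef_def sum_2 algebra_simps)
  then show ?thesis by (simp add: euler_l m_up_eq)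
qed

lemma d_op_angle: "d_op (N_coef F \<theta> kf) n \<theta> x y = kf n x"
proof -
  have s: "sqrt (det (g_mat F x y)) > 0" using det_g_pos by simp
  have F: "F x y > 0" by (rule F_pos[OF W])
  have th: "Dy n \<theta> x y = m_low F n x y / F x y" for n
    using F_Dy_angle[OF W, of n] F by (simp add: field_simps)
  have "m_up F 1 x y * m_low F 1 x y + m_up F 2 x y * m_low F 2 x y = 1"
    using s euler_l by (simp add: m_up_eq m_low_eq field_simps)
  moreover have "l_up F 1 x y * m_low F 1 x y + l_up F 2 x y * m_low F 2 x y = 0"
    by (simp add: m_low_eq)
  moreover have "d_op (N_coef F \<theta> kf) n \<theta> x y
      = Dx n \<theta> x y
        - Dx n F x y * (l_up F 1 x y * m_low F 1 x y + l_up F 2 x y * m_low F 2 x y) / F x y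
        - (Dx n \<theta> x y - kf n x) * (m_up F 1 x y * m_low F 1 x y + m_up F 2 x y * m_low F 2 x y)"
    using F by (simp add: d_op_def N_coef_def sum_2 th field_simps)
  ultimately show ?thesis by simp
qed

end

lemma fdiff_m_up:
  assumes W: "(x, y) \<in> W"
  shows "fdiff (m_up F k) x y"
proof -
  \<comment> \<open>The determinant of \<open>g\<close> in terms of derivatives of \<open>F\<close>, equal to it on \<open>W\<close>, where
    \<open>g\<close> is symmetric.\<close>
  define det' where "det' = (\<lambda>x y. (Dy 1 F x y * Dy 1 F x y + F x y * Dy 1 (Dy 1 F) x y)
      * (Dy 2 F x y * Dy 2 F x y + F x y * Dy 2 (Dy 2 F) x y)
      - (Dy 1 F x y * Dy 2 F x y + F x y * Dy 2 (Dy 1 F) x y)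
        * (Dy 1 F x y * Dy 2 F x y + F x y * Dy 2 (Dy 1 F) x y))"
  have det': "det (g_mat F x y) = det' x y" if "(x, y) \<in> W" for x y
    using that by (simp add: det_g g_low_eq det'_def power2_eq_square)
  have "fdiff det' x y"
    unfolding det'_def
    by (intro fdiff_add fdiff_diff fdiff_mult fdiff_F fdiff_Dy_F fdiff_Dy_Dy_F W)
  moreover have pos: "det' x y > 0" using det'[OF W] det_g_pos[OF W] by simp
  ultimately have s: "fdiff (\<lambda>x y. sqrt (det' x y)) x y" by (rule fdiff_sqrt)
  have "fdiff (m_up F 1) x y"
    by (rule fdiff_cong_open[OF open_W W, of _ "\<lambda>x y. - Dy 2 F x y / sqrt (det' x y)"])
      (use pos in \<open>auto simp: m_up_eq det' intro!: fdiff_divide fdiff_minus fdiff_Dy_F s W\<close>)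
  moreover have "fdiff (m_up F 2) x y"
    by (rule fdiff_cong_open[OF open_W W, of _ "\<lambda>x y. Dy 1 F x y / sqrt (det' x y)"])
      (use pos in \<open>auto simp: m_up_eq det' intro!: fdiff_divide fdiff_Dy_F s W\<close>)
  ultimately show ?thesis using exhaust_2[of k] by auto
qed

text \<open>The operator \<open>deriv\<close> says nothing where the derivative does not exist, so the product rule
  used on \<open>N\<^sup>k\<^sub>n \<partial>f/\<partial>y\<^sup>k\<close> requires this.\<close>

lemma fdiff_N_coef:
  assumes W: "(x, y) \<in> W" and kf: "kf n differentiable at x"
  shows "fdiff (N_coef F \<theta> kf k n) x y"
proof -
  have "fdiff (\<lambda>x y. kf n x) x y"
    using differentiable_compose[of "kf n" fst "(x, y)" UNIV] kf
    by (simp add: case_prod_beta' bounded_linear_imp_differentiable bounded_linear_fst)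
  moreover have "fdiff (l_up F k) x y"
    using F_pos[OF W] fdiff_divide[OF fdiff_component[of k] fdiff_F[OF W]]
    by (simp add: l_up_def[abs_def])
  ultimately have "fdiff (\<lambda>x y. - (l_up F k x y) * Dx n F x y
      - F x y * m_up F k x y * (Dx n \<theta> x y - kf n x)) x y"
    by (intro fdiff_diff fdiff_mult fdiff_minus fdiff_Dx_F fdiff_F fdiff_m_up fdiff_Dx_angle W)
  then show ?thesis by (simp add: N_coef_def[abs_def])
qed

lemma metricity:
  assumes W: "(x, y) \<in> W" and kf: "kf i differentiable at x"
    and N: "N = N_coef F \<theta> kf" and D: "D = D_coef F \<theta> kf"
  shows "cov_deriv1 N D i (y_low F) j x y = 0"
    and "cov_deriv2 N D i (g_low F) j n x y = 0"
proof -
  have D: "D = (\<lambda>k n m x y. - Dy m (N k n) x y)"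
    by (simp add: fun_eq_iff D N D_coef_def)
  have dN: "fdiff (N k i) x y" for k
    unfolding N by (rule fdiff_N_coef[where kf = kf, OF W kf])
  have l: "cov_deriv1 N D i (\<lambda>j. Dy j F) j x y = 0" for j
    unfolding D
    by (rule cov_deriv1_vertical_gradient[where N = N and i = i and c = "\<lambda>_. 0", OF open_W W F_C2 dN]) (simp add: N d_op_F)
  have \<theta>: "cov_deriv1 N D i (\<lambda>j. Dy j \<theta>) j x y = 0" for j
    unfolding D
    by (rule cov_deriv1_vertical_gradient[where N = N and i = i and c = "kf i", OF open_W W angle_C2 dN]) (simp add: N d_op_angle)
  have dF: "d_op N i F x y = 0" using d_op_F[OF W] by (simp add: N)
  show "cov_deriv1 N D i (y_low F) j x y = 0"
    using cov_deriv1_scale[OF fdiff_F[OF W] fdiff_Dy_F[OF W] dF l] by (simp add: y_low_def[abs_def])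
  show "cov_deriv2 N D i (g_low F) j n x y = 0"
  proof (rule cov_deriv2_sum_of_squares[OF open_W W])
    show "g_low F j n x y = Dy j F x y * Dy n F x y + (F x y * Dy j \<theta> x y) * (F x y * Dy n \<theta> x y)"
      if "(x, y) \<in> W" for j n x y
      using g_decomposition[OF that] F_Dy_angle[OF that] by simp
    show "fdiff (Dy j F) x y" for j by (rule fdiff_Dy_F[OF W])
    show "fdiff (\<lambda>x y. F x y * Dy j \<theta> x y) x y" for j
      by (intro fdiff_mult fdiff_F fdiff_Dy_angle W)
    show "cov_deriv1 N D i (\<lambda>j. Dy j F) j x y = 0" for j by (rule l)
    show "cov_deriv1 N D i (\<lambda>j x y. F x y * Dy j \<theta> x y) j x y = 0" for j
      by (rule cov_deriv1_scale[OF fdiff_F[OF W] fdiff_Dy_angle[OF W] dF \<theta>])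
  qed
qed

end

lemma dir_deriv_slice:
  assumes "fdiff f x y"
  shows "((\<lambda>t. f (x + t *\<^sub>R v) y) has_real_derivative dir_deriv (\<lambda>x. f x y) v x) (at 0)"
    and "((\<lambda>t. f x (y + t *\<^sub>R v)) has_real_derivative dir_deriv (f x) v y) (at 0)"
  using dir_deriv_line[of "case_prod f" "(x, y)" 0 "(v, 0)"]
    dir_deriv_line[of "case_prod f" "(x, y)" 0 "(0, v)"] assms
  by (simp_all add: dir_deriv_def)

lemma d2_op_difference:
  assumes "fdiff f x y\<^sub>1" "fdiff f x y\<^sub>2"
  shows "d2_op N n (\<lambda>x y\<^sub>1 y\<^sub>2. f x y\<^sub>2 - f x y\<^sub>1) x y\<^sub>1 y\<^sub>2 = d_op N n f x y\<^sub>2 - d_op N n f x y\<^sub>1"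
proof -
  have "dir_deriv (\<lambda>x. f x y\<^sub>2 - f x y\<^sub>1) (axis n 1) x = Dx n f x y\<^sub>2 - Dx n f x y\<^sub>1"
    unfolding Dx_def by (intro dir_deriv_eqI DERIV_diff dir_deriv_slice assms)
  moreover have "dir_deriv (\<lambda>y. f x y\<^sub>2 - f x y) (axis k 1) y\<^sub>1 = - Dy k f x y\<^sub>1" for k
    unfolding Dy_def using DERIV_diff[OF DERIV_const dir_deriv_slice(2)[OF assms(1)]]
    by (intro dir_deriv_eqI) simp
  moreover have "dir_deriv (\<lambda>y. f x y - f x y\<^sub>1) (axis k 1) y\<^sub>2 = Dy k f x y\<^sub>2" for k
    unfolding Dy_def using DERIV_diff[OF dir_deriv_slice(2)[OF assms(2)] DERIV_const]
    by (intro dir_deriv_eqI) simp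
  ultimately show ?thesis
    by (simp add: d2_op_def d_op_def sum_2)
qed

theorem mainTheorem2:
  fixes U :: "(real^2) set" and W :: "((real^2) \<times> (real^2)) set"
    and F \<theta> :: "real^2 \<Rightarrow> real^2 \<Rightarrow> real"
    and kf :: "2 \<Rightarrow> real^2 \<Rightarrow> real"
    and N :: "2 \<Rightarrow> 2 \<Rightarrow> real^2 \<Rightarrow> real^2 \<Rightarrow> real"
    and D :: "2 \<Rightarrow> 2 \<Rightarrow> 2 \<Rightarrow> real^2 \<Rightarrow> real^2 \<Rightarrow> real"
  assumes "conic_region U W"
    and "finsler_on W F"
    and "angle_function_on W F \<theta>"
    and "\<forall>n. smooth_on (kf n) U"
    and "N = N_coef F \<theta> kf"
    and "D = D_coef F \<theta> kf"
  shows "(\<forall>x y\<^sub>1 y\<^sub>2 n. (x, y\<^sub>1) \<in> W \<longrightarrow> (x, y\<^sub>2) \<in> W \<longrightarrow>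
            d2_op N n (\<lambda>x y\<^sub>1 y\<^sub>2. \<theta> x y\<^sub>2 - \<theta> x y\<^sub>1) x y\<^sub>1 y\<^sub>2 = d_op N n \<theta> x y\<^sub>2 - d_op N n \<theta> x y\<^sub>1 \<and>
            d_op N n \<theta> x y\<^sub>2 - d_op N n \<theta> x y\<^sub>1 = 0)
       \<and> (\<forall>x y. (x, y) \<in> W \<longrightarrow>
            (\<forall>i j. cov_deriv1 N D i (y_low F) j x y = 0) \<and>
            (\<forall>i j n. cov_deriv2 N D i (g_low F) j n x y = 0))"
proof -
  interpret finsler_angle W F \<theta>
    using assms(1-3) by unfold_locales (auto simp: conic_region_def)
  have kf: "kf n differentiable at x" if "(x, y) \<in> W" for n x y
  proof (rule Ck_on_differentiable[of 0])
    show "Ck_on (Suc 0) (kf n) U" using assms(4) unfolding smooth_on_def by blast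
    show "open U" "x \<in> U" using assms(1) that by (auto simp: conic_region_def)
  qed
  show ?thesis
    using d2_op_difference[of \<theta>] fdiff_angle d_op_angle[of _ _ kf] metricity[OF _ kf assms(5,6)]
    by (simp add: assms(5))
qed

end
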